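(* Let $F$ be a differentiable general preinvex function on the general invex set $K_{g\eta}$. Let $u\in H$ with $g(u)\in K_{g\eta}$. Then $u$ is a minimum of $F$ on $K_{g\eta}$, that is, $F(g(u))\le F(g(v))$ for all $v\in H$ with $g(v)\in K_{g\eta}$, if and only if $$\langle F'(g(u)),\,\eta(g(v),g(u))\rangle\ge 0\qquad\text{for all } v\in H\text{ with } g(v)\in K_{g\eta},$$ where $F'(g(u))$ is the Fréchet derivative of $F$ at $g(u)\in K_{g\eta}$.
   Context: $H$ is a real Hilbert space with inner product $\langle\cdot,\cdot\rangle$; $g:H\to H$ is an arbitrary function and $\eta(\cdot,\cdot)$ is a continuous $H$-valued bifunction. A nonempty closed set $K_{g\eta}\subseteq H$ is a general invex set with respect to $\eta$ and $g$ if $g(u)+t\,\eta(g(v),g(u))\in K_{g\eta}$ for all $u,v\in H$ with $g(u),g(v)\in K_{g\eta}$ and all $t\in[0,1]$. As a standing assumption, $g$ is onto the constraint set (every point of $K_{g\eta}$ is $g(v)$ for some $v\in H$). A function $F:K_{g\eta}\to\mathbb{R}$ is general preinvex if $$F\big(g(u)+t\,\eta(g(v),g(u))\big)\le(1-t)F(g(u))+tF(g(v))$$ for all $u,v\in H$ with $g(u),g(v)\in K_{g\eta}$ and all $t\in[0,1]$. "Differentiable" means Fréchet differentiable at the points of $K_{g\eta}$ ($F$ being understood as defined near $K_{g\eta}$), with the derivative identified with an element of $H$. *)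

theory Defs
  imports "HOL-Analysis.Analysis"
begin

definition general_invex_set ::
  "'a::real_inner set \<Rightarrow> ('a \<Rightarrow> 'a \<Rightarrow> 'a) \<Rightarrow> ('a \<Rightarrow> 'a) \<Rightarrow> bool" where
  "general_invex_set K \<eta> g \<longleftrightarrow>
     K \<noteq> {} \<and> closed K \<and>
     (\<forall>u v. g u \<in> K \<longrightarrow> g v \<in> K \<longrightarrow>
        (\<forall>t\<in>{0..1::real}. g u + t *\<^sub>R \<eta> (g v) (g u) \<in> K))"

definition general_preinvex_on ::
  "'a::real_inner set \<Rightarrow> ('a \<Rightarrow> 'a \<Rightarrow> 'a) \<Rightarrow> ('a \<Rightarrow> 'a) \<Rightarrow> ('a \<Rightarrow> real) \<Rightarrow> bool" where
  "general_preinvex_on K \<eta> g F \<longleftrightarrow>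
     (\<forall>u v. g u \<in> K \<longrightarrow> g v \<in> K \<longrightarrow>
        (\<forall>t\<in>{0..1::real}. F (g u + t *\<^sub>R \<eta> (g v) (g u)) \<le> (1 - t) * F (g u) + t * F (g v)))"

(* The Riesz representative of the Frechet derivative. At a point of differentiability
   in a Hilbert space it exists and is unique; elsewhere the value is unspecified. *)
definition gradient :: "('a::real_inner \<Rightarrow> real) \<Rightarrow> 'a \<Rightarrow> 'a" where
  "gradient F x = (THE D. GDERIV F x :> D)"

lemma gradient_eqI:
  assumes "GDERIV F x :> D"
  shows "gradient F x = D"
  unfolding gradient_def
proof (rule the_equality)
  show "GDERIV F x :> D" by (rule assms)
next
  fix E assume "GDERIV F x :> E"
  then have "(\<lambda>h. inner h E) = (\<lambda>h. inner h D)"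
    using assms unfolding gderiv_def by (rule has_derivative_unique)
  then show "E = D"
    by (metis vector_eq_ldot)
qed

end

theory Submission
  imports Defs
begin

text \<open>
  Everything happens along the segments \<open>g u + t \<eta>(g v, g u)\<close>, \<open>0 \<le> t \<le> 1\<close>, on which \<open>F\<close>
  becomes a real function \<open>\<phi>\<close> whose derivative at \<open>0\<close> is \<open>\<langle>F'(g u), \<eta>(g v, g u)\<rangle>\<close>.
  By invexity the segment stays in \<open>K\<close>, and since \<open>g\<close> is onto \<open>K\<close>, a minimum of \<open>F\<close> over the
  points \<open>g v\<close> in \<open>K\<close> is a minimum of \<open>\<phi>\<close> on \<open>[0, 1]\<close> at the left endpoint; hence
  \<open>\<phi>'(0) \<ge> 0\<close>.  Conversely, preinvexity says that \<open>\<phi>\<close> lies below the chord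
  \<open>\<phi>(0) + t (F (g v) - F (g u))\<close>, which it touches at \<open>0\<close>, so that
  \<open>\<phi>'(0) \<le> F (g v) - F (g u)\<close>: if the left-hand side is nonnegative, so is the right-hand side.

  Both halves use the same fact about one-sided minima of real functions, applied to \<open>\<phi>\<close> and to
  the difference of chord and \<open>\<phi>\<close> (\<open>deriv_nonneg_at_left_endpoint_min\<close>).  Completeness enters
  through the Riesz representation theorem (\<open>riesz_representation\<close>), which turns
  the Frechet derivative into a gradient vector.
\<close>

text \<open>
  The representing vector is the minimiser of the quadratic functional
  \<open>J x = \<langle>x, x\<rangle> - 2 f x\<close>: completing the square for a representing vector \<open>D\<close> would give
  \<open>J x = \<parallel>x - D\<parallel>\<^sup>2 - \<parallel>D\<parallel>\<^sup>2\<close>.  The parallelogram law makes every minimising sequence Cauchy,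
  and the vanishing of the first variation of \<open>J\<close> at the minimiser is the claim.
\<close>

lemma riesz_representation:
  fixes f :: "'a::{real_inner, complete_space} \<Rightarrow> real"
  assumes "bounded_linear f"
  obtains D where "\<And>h. f h = inner h D"
proof -
  interpret f: bounded_linear f by (rule assms)
  define J where "J x = inner x x - 2 * f x" for x
  define m where "m = Inf (range J)"
  obtain B where B: "\<And>x. norm (f x) \<le> norm x * B"
    using f.bounded by blast
  have "- (B\<^sup>2) \<le> J x" for x
  proof -
    have "0 \<le> (norm x - B)\<^sup>2" by simp
    moreover have "f x \<le> norm x * B" using B[of x] by simp
    ultimately show ?thesis
      unfolding J_def power2_norm_eq_inner[symmetric]
      by (simp add: power2_eq_square algebra_simps)
  qed
  then have bdd: "bdd_below (range J)" by (auto intro!: bdd_belowI2)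
  have m_le: "m \<le> J x" for x
    unfolding m_def using bdd by (intro cInf_lower) auto
  have "\<exists>x. J x < m + inverse (real (Suc n))" for n
  proof -
    have "Inf (range J) < m + inverse (real (Suc n))" by (simp add: m_def)
    then show ?thesis using cInf_lessD[of "range J"] by blast
  qed
  then obtain X where X: "\<And>n. J (X n) < m + inverse (real (Suc n))" by metis
  have parallelogram: "(dist x y)\<^sup>2 \<le> 2 * (J x + J y - 2 * m)" for x y
  proof -
    have "(dist x y)\<^sup>2 = 2 * (J x + J y - 2 * J ((1/2) *\<^sub>R (x + y)))"
      unfolding J_def dist_norm power2_norm_eq_inner
      by (simp add: f.scaleR f.add inner_add inner_diff inner_commute algebra_simps)
    with m_le[of "(1/2) *\<^sub>R (x + y)"] show ?thesis by simp
  qed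
  have "Cauchy X"
  proof (rule metric_CauchyI)
    fix e :: real assume "0 < e"
    then obtain N where N: "inverse (real (Suc N)) < e\<^sup>2 / 4"
      using reals_Archimedean[of "e\<^sup>2 / 4"] by auto
    show "\<exists>M. \<forall>i\<ge>M. \<forall>j\<ge>M. dist (X i) (X j) < e"
    proof (intro exI allI impI)
      fix i j assume "N \<le> i" "N \<le> j"
      then have "inverse (real (Suc i)) \<le> inverse (real (Suc N))"
        and "inverse (real (Suc j)) \<le> inverse (real (Suc N))" by (simp_all add: field_simps)
      then have "(dist (X i) (X j))\<^sup>2 < e\<^sup>2"
        using parallelogram[of "X i" "X j"] X[of i] X[of j] N by argo
      then show "dist (X i) (X j) < e"
        using \<open>0 < e\<close> by (meson less_imp_le power2_less_imp_less)
    qed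
  qed
  then obtain D where D: "X \<longlonglongrightarrow> D" using Cauchy_convergent convergent_def by blast
  have "(\<lambda>n. J (X n)) \<longlonglongrightarrow> J D"
    unfolding J_def by (intro tendsto_intros D f.tendsto)
  moreover have "(\<lambda>n. m + inverse (real (Suc n))) \<longlonglongrightarrow> m + 0"
    by (intro tendsto_intros LIMSEQ_inverse_real_of_nat)
  ultimately have "J D \<le> m + 0"
    by (rule LIMSEQ_le) (use X less_imp_le in blast)
  with m_le have J_min: "J D \<le> J x" for x by (metis add_0_right order_trans)
  have "f h = inner h D" for h
  proof -
    let ?\<phi> = "\<lambda>t. J (D + t *\<^sub>R h)"
    have "?\<phi> = (\<lambda>t. J D + 2 * t * (inner h D - f h) + t\<^sup>2 * inner h h)"
      unfolding J_def
      by (rule ext)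
         (simp add: f.scaleR f.add inner_add inner_commute power2_eq_square algebra_simps)
    then have "(?\<phi> has_real_derivative 2 * (inner h D - f h)) (at 0)"
      by (auto intro!: derivative_eq_intros)
    moreover have "\<forall>t. \<bar>0 - t\<bar> < 1 \<longrightarrow> ?\<phi> 0 \<le> ?\<phi> t" using J_min by simp
    ultimately have "2 * (inner h D - f h) = 0" by (rule DERIV_local_min[OF _ zero_less_one])
    then show ?thesis by simp
  qed
  then show ?thesis by (rule that)
qed

lemma differentiable_imp_GDERIV_gradient:
  fixes F :: "'a::{real_inner, complete_space} \<Rightarrow> real"
  assumes "F differentiable (at x)"
  shows "GDERIV F x :> gradient F x"
proof -
  obtain F' where F': "(F has_derivative F') (at x)"
    using assms unfolding differentiable_def by blast
  obtain D where "\<And>h. F' h = inner h D"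
    using riesz_representation[OF has_derivative_bounded_linear[OF F']] by blast
  then have "F' = (\<lambda>h. inner h D)" by blast
  with F' have "GDERIV F x :> D" by (simp add: gderiv_def)
  then show ?thesis using gradient_eqI by metis
qed

lemma GDERIV_directional_derivative:
  assumes "GDERIV F x :> D"
  shows "((\<lambda>t. F (x + t *\<^sub>R h)) has_real_derivative inner D h) (at 0)"
proof -
  have "((\<lambda>t. x + t *\<^sub>R h) has_derivative (\<lambda>t. t *\<^sub>R h)) (at 0)"
    by (auto intro!: derivative_eq_intros)
  moreover have "(F has_derivative (\<lambda>k. inner k D)) (at (x + 0 *\<^sub>R h))"
    using assms by (simp add: gderiv_def)
  ultimately have "((\<lambda>t. F (x + t *\<^sub>R h)) has_derivative (\<lambda>t. inner (t *\<^sub>R h) D)) (at 0)"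
    by (rule has_derivative_compose)
  then show ?thesis
    by (simp add: has_field_derivative_def inner_commute mult_commute_abs)
qed

text \<open>
  A negative derivative would make the function drop below its value at \<open>0\<close> immediately to
  the right of \<open>0\<close>.
\<close>

lemma deriv_nonneg_at_left_endpoint_min:
  fixes \<phi> :: "real \<Rightarrow> real"
  assumes "(\<phi> has_real_derivative c) (at 0)"
    and min: "\<And>t. t \<in> {0..1} \<Longrightarrow> \<phi> 0 \<le> \<phi> t"
  shows "0 \<le> c"
proof (rule ccontr)
  assume "\<not> 0 \<le> c"
  then obtain d where "0 < d" and d: "\<forall>h>0. h < d \<longrightarrow> \<phi> (0 + h) < \<phi> 0"
    using DERIV_neg_dec_right[OF assms(1)] by force
  define t where "t = min 1 (d / 2)"
  have "0 < t" "t < d" "t \<le> 1" using \<open>0 < d\<close> by (auto simp: t_def)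
  then show False using d min[of t] by force
qed

text \<open>
  The preinvex form of the gradient inequality for convex functions: \<open>F\<close> restricted to the
  segment lies below its chord and meets it at \<open>t = 0\<close>, so the slope of \<open>F\<close> there is at most
  the slope of the chord.
\<close>

lemma general_preinvex_gradient_inequality:
  assumes preinvex: "general_preinvex_on K \<eta> g F"
    and K: "g u \<in> K" "g v \<in> K"
    and D: "GDERIV F (g u) :> D"
  shows "inner D (\<eta> (g v) (g u)) \<le> F (g v) - F (g u)"
proof -
  let ?\<phi> = "\<lambda>t. F (g u + t *\<^sub>R \<eta> (g v) (g u))"
  let ?s = "F (g v) - F (g u)"
  have "((\<lambda>t. t * ?s - ?\<phi> t) has_real_derivative ?s - inner D (\<eta> (g v) (g u))) (at 0)"
    using GDERIV_directional_derivative[OF D] by (auto intro!: derivative_eq_intros)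
  moreover have "0 * ?s - ?\<phi> 0 \<le> t * ?s - ?\<phi> t" if "t \<in> {0..1}" for t
  proof -
    have "?\<phi> t \<le> (1 - t) * F (g u) + t * F (g v)"
      using preinvex K that unfolding general_preinvex_on_def by blast
    then show ?thesis by (simp add: algebra_simps)
  qed
  ultimately have "0 \<le> ?s - inner D (\<eta> (g v) (g u))"
    by (rule deriv_nonneg_at_left_endpoint_min)
  then show ?thesis by simp
qed

theorem theorem10:
  fixes K :: "'a::{real_inner, complete_space} set"
    and g :: "'a \<Rightarrow> 'a"
    and \<eta> :: "'a \<Rightarrow> 'a \<Rightarrow> 'a"
    and F :: "'a \<Rightarrow> real"
    and u :: 'a
  assumes "continuous_on UNIV (\<lambda>(x, y). \<eta> x y)"
    and "general_invex_set K \<eta> g"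
    and "K \<subseteq> range g"
    and "general_preinvex_on K \<eta> g F"
    and "\<And>x. x \<in> K \<Longrightarrow> F differentiable (at x)"
    and "g u \<in> K"
  shows "(\<forall>v. g v \<in> K \<longrightarrow> F (g u) \<le> F (g v)) \<longleftrightarrow>
         (\<forall>v. g v \<in> K \<longrightarrow> inner (gradient F (g u)) (\<eta> (g v) (g u)) \<ge> 0)"
proof -
  have D: "GDERIV F (g u) :> gradient F (g u)"
    by (intro differentiable_imp_GDERIV_gradient assms)
  show ?thesis
  proof (intro iffI allI impI)
    fix v assume min: "\<forall>v. g v \<in> K \<longrightarrow> F (g u) \<le> F (g v)" and v: "g v \<in> K"
    let ?\<phi> = "\<lambda>t. F (g u + t *\<^sub>R \<eta> (g v) (g u))"
    have "?\<phi> 0 \<le> ?\<phi> t" if "t \<in> {0..1}" for t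
    proof -
      have "g u + t *\<^sub>R \<eta> (g v) (g u) \<in> K"
        using assms(2) \<open>g u \<in> K\<close> v that unfolding general_invex_set_def by blast
      moreover from this obtain w where "g u + t *\<^sub>R \<eta> (g v) (g u) = g w"
        using \<open>K \<subseteq> range g\<close> by blast
      ultimately show ?thesis using min by simp
    qed
    then show "0 \<le> inner (gradient F (g u)) (\<eta> (g v) (g u))"
      by (rule deriv_nonneg_at_left_endpoint_min[OF GDERIV_directional_derivative[OF D]])
  next
    fix v
    assume "\<forall>v. g v \<in> K \<longrightarrow> inner (gradient F (g u)) (\<eta> (g v) (g u)) \<ge> 0" and v: "g v \<in> K"
    then have "0 \<le> inner (gradient F (g u)) (\<eta> (g v) (g u))" by blast
    also have "\<dots> \<le> F (g v) - F (g u)"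
      by (rule general_preinvex_gradient_inequality[OF assms(4,6) v D])
    finally show "F (g u) \<le> F (g v)" by simp
  qed
qed

end
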